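(* Let $x \in (0,1)$ be irrational. Suppose that for every integer $k \geq 1$ and every string $s$ of $k$ positive integers, $$\lim_{n\to\infty} \frac{|\{i \in \mathbb{Z} \mid 0 \leq i \leq \tfrac{n}{k},\ T^{ki}x \in C_s\}|}{n/k} = \gamma(C_s).$$ Then for every finite string $s$ of positive integers, $$\lim_{n\to\infty} \frac{|\{i \in \mathbb{Z} \mid 0 \leq i \leq n,\ T^{i}x \in C_s\}|}{n} = \gamma(C_s).$$
   Context: Every irrational $x\in(0,1)$ has a unique continued fraction expansion $x=[0;a_1,a_2,\dots]$ with $a_i$ positive integers. For a finite string $w=w_1\dots w_m$ of positive integers, the cylinder $C_w$ is the set of $x\in[0,1]$ whose continued fraction expansion $[0;a_1,a_2,\dots]$ has $w$ as a prefix, i.e. $a_i=w_i$ for $1\le i\le m$. $\gamma$ is the Gauss measure on Borel subsets of $(0,1)$: $\gamma(A)=\frac{1}{\ln 2}\int_A \frac{1}{1+x}\,dx$. $T$ is the Gauss map $T(x)=\frac1x-\lfloor\frac1x\rfloor$, which acts on expansions as the left shift $T([0;a_1,a_2,\dots])=[0;a_2,a_3,\dots]$. The variable $n$ ranges over positive integers. *)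

theory Defs
  imports "HOL-Analysis.Analysis"
begin

text \<open>\<open>cf_value [w\<^sub>1, \<dots>, w\<^sub>m]\<close> is the finite continued fraction \<open>[0; w\<^sub>1, \<dots>, w\<^sub>m]\<close>.\<close>

fun cf_value :: "nat list \<Rightarrow> real" where
  "cf_value [] = 0"
| "cf_value (a # as) = 1 / (real a + cf_value as)"

text \<open>Sequences are indexed from \<open>0\<close>, so the partial quotient \<open>a\<^sub>i\<close> is \<open>a (i - 1)\<close>.\<close>

definition is_cf_expansion :: "(nat \<Rightarrow> nat) \<Rightarrow> real \<Rightarrow> bool" where
  "is_cf_expansion a x \<longleftrightarrow>
     (\<forall>i. a i \<ge> 1) \<and> (\<lambda>m. cf_value (map a [0..<m])) \<longlonglongrightarrow> x"

text \<open>Only infinite expansions count, so rational points, whose (two) expansions are finite,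
  lie in no cylinder. They form a null set and are never reached from an irrational point
  under the Gauss map.\<close>

definition cylinder :: "nat list \<Rightarrow> real set" where
  "cylinder w =
     {x \<in> {0..1}. \<exists>a. is_cf_expansion a x \<and> (\<forall>i < length w. a i = w ! i)}"

text \<open>The Gauss measure, extended by zero from \<open>(0,1)\<close> to all Borel subsets of the real line.\<close>

definition gauss_measure :: "real measure" where
  "gauss_measure =
     density lborel (\<lambda>x. ennreal (indicator {0<..<1} x * (1 / ln 2) * (1 / (1 + x))))"

definition gauss_map :: "real \<Rightarrow> real" where
  "gauss_map x = 1 / x - of_int \<lfloor>1 / x\<rfloor>"

end

theory Submission
  imports Defs "HOL-Probability.Distribution_Functions" "HOL-Real_Asymp.Real_Asymp"
begin

text \<open>Cut the expansion of \<open>x\<close> into aligned blocks of length \<open>k\<close>. The frequencies of the single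
  blocks converge to a probability distribution on a countable set, so no mass escapes and the
  frequency of every set of blocks converges. Applied to the blocks that contain \<open>s\<close> at offset \<open>j\<close>,
  with \<open>j + m \<le> k\<close> where \<open>m\<close> is the length of \<open>s\<close>, the limit is \<open>\<gamma>(C\<^sub>s)\<close> by invariance of the
  Gauss measure. Summing over \<open>j\<close> and letting \<open>k\<close> grow gives \<open>\<gamma>(C\<^sub>s)\<close> as a lower bound for the limit
  inferior of the frequency of \<open>s\<close> over all positions. Since these bounds for the strings of length
  \<open>m\<close> add up to \<open>1\<close>, they are attained.\<close>

section \<open>Setwise convergence of frequencies\<close>

text \<open>Lower bounds for single values add up over finite sets and, by continuity from below,
  pass to every set. The lower bound for the complement turns into an upper bound, because the total
  frequency tends to 1. Only lower bounds are assumed, since the second application, to all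
  positions, has nothing more to offer.\<close>

lemma frequency_tendsto_prob:
  fixes X :: "'b \<Rightarrow> 'a::countable" and u :: "nat \<Rightarrow> 'a" and N :: "nat \<Rightarrow> nat" and r :: "nat \<Rightarrow> real"
  assumes M: "prob_space M" and X [measurable]: "X \<in> measurable M (count_space UNIV)"
    and r: "\<And>n. r n \<ge> 0"
    and total: "(\<lambda>n. real (card {..N n}) / r n) \<longlonglongrightarrow> 1"
    and lower: "\<And>w c. c < measure M {y \<in> space M. X y = w} \<Longrightarrow>
      \<forall>\<^sub>F n in sequentially. c < real (card {i. i \<le> N n \<and> u i = w}) / r n"
  shows "(\<lambda>n. real (card {i. i \<le> N n \<and> u i \<in> A}) / r n) \<longlonglongrightarrow> measure M {y \<in> space M. X y \<in> A}"
proof -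
  interpret prob_space M by fact
  define f where "f A n = real (card {i. i \<le> N n \<and> u i \<in> A}) / r n" for A n
  define P where "P A = prob {y \<in> space M. X y \<in> A}" for A
  have fin: "finite {i. i \<le> N n \<and> Q i}" for n Q
    by (rule finite_subset[of _ "{..N n}"]) auto
  have f_disj: "f (A \<union> B) n = f A n + f B n" if "A \<inter> B = {}" for A B n
  proof -
    have "{i. i \<le> N n \<and> u i \<in> A \<union> B} = {i. i \<le> N n \<and> u i \<in> A} \<union> {i. i \<le> N n \<and> u i \<in> B}" by auto
    moreover have "card \<dots> = card {i. i \<le> N n \<and> u i \<in> A} + card {i. i \<le> N n \<and> u i \<in> B}"
      using that by (intro card_Un_disjoint fin) auto
    ultimately show ?thesis by (simp add: f_def add_divide_distrib)
  qed
  have P_disj: "P (A \<union> B) = P A + P B" if "A \<inter> B = {}" for A B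
  proof -
    have "{y \<in> space M. X y \<in> A \<union> B} = {y \<in> space M. X y \<in> A} \<union> {y \<in> space M. X y \<in> B}" by auto
    then show ?thesis unfolding P_def
      using that by (simp only:) (intro finite_measure_Union; auto)
  qed
  have f_mono: "f A n \<le> f B n" if "A \<subseteq> B" for A B n
    unfolding f_def using that r by (intro divide_right_mono of_nat_mono card_mono fin) auto
  have lower_finite: "\<forall>\<^sub>F n in sequentially. c < f F n" if "finite F" "c < P F" for F c
    using that
  proof (induction F arbitrary: c)
    case empty
    then show ?case by (simp add: f_def P_def)
  next
    case (insert w F)
    define e where "e = (P (insert w F) - c) / 2"
    have e: "e > 0" using insert.prems by (simp add: e_def)
    have P: "P (insert w F) = P {w} + P F" using P_disj[of "{w}" F] insert.hyps by simp
    have "\<forall>\<^sub>F n in sequentially. P {w} - e < f {w} n"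
      using lower[of "P {w} - e" w] e by (simp add: f_def P_def)
    moreover have "\<forall>\<^sub>F n in sequentially. P F - e < f F n"
      using insert.IH[of "P F - e"] e by simp
    ultimately show ?case
    proof eventually_elim
      case (elim n)
      have "f (insert w F) n = f {w} n + f F n" using f_disj[of "{w}" F] insert.hyps by simp
      then show ?case using elim P by (simp add: e_def field_simps)
    qed
  qed
  have lower_set: "\<forall>\<^sub>F n in sequentially. c < f B n" if "c < P B" for B c
  proof -
    \<comment> \<open>The enumeration \<open>to_nat\<close> exhausts \<open>B\<close> by finite
      sets, so some \<open>F n\<close> already has probability above \<open>c\<close>.\<close>
    define F where "F n = B \<inter> {w. to_nat w < n}" for n
    have fF: "finite (F n)" for n
    proof -
      have "finite (to_nat -` {..<n} :: 'a set)" by (rule finite_vimageI) auto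
      then show ?thesis by (rule finite_subset[rotated]) (auto simp: F_def)
    qed
    have "(\<lambda>n. prob {y \<in> space M. X y \<in> F n}) \<longlonglongrightarrow> prob (\<Union>n. {y \<in> space M. X y \<in> F n})"
      by (intro finite_Lim_measure_incseq) (auto simp: incseq_def F_def)
    moreover have "(\<Union>n. {y \<in> space M. X y \<in> F n}) = {y \<in> space M. X y \<in> B}"
      by (auto simp: F_def)
    ultimately have "(\<lambda>n. P (F n)) \<longlonglongrightarrow> P B" by (simp add: P_def)
    then have "\<forall>\<^sub>F n in sequentially. c < P (F n)" using that by (rule order_tendstoD)
    then obtain n where "c < P (F n)" by (auto simp: eventually_sequentially)
    from lower_finite[OF fF this] show ?thesis
      by eventually_elim (use f_mono[of "F n" B] in \<open>auto simp: F_def intro: less_le_trans\<close>)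
  qed
  have "f A \<longlonglongrightarrow> P A"
  proof (rule order_tendstoI)
    fix c assume "c < P A" then show "\<forall>\<^sub>F n in sequentially. c < f A n" by (rule lower_set)
  next
    fix c assume c: "P A < c"
    \<comment> \<open>One \<open>e\<close> is spent on the lower bound for \<open>- A\<close>, the
      other on the total frequency; \<open>f A n\<close> then stays below
      \<open>P A + 2 * e = c\<close>.\<close>
    define e where "e = (c - P A) / 2"
    have e: "e > 0" using c by (simp add: e_def)
    have PU: "P A + P (- A) = 1" using P_disj[of A "- A"] by (simp add: P_def prob_space)
    have "\<forall>\<^sub>F n in sequentially. P (- A) - e < f (- A) n" using e by (intro lower_set) simp
    moreover have "\<forall>\<^sub>F n in sequentially. real (card {..N n}) / r n < 1 + e"
      using total e by (intro order_tendstoD) auto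
    moreover have "f UNIV n = real (card {..N n}) / r n" for n by (simp add: f_def atMost_def)
    ultimately have "\<forall>\<^sub>F n in sequentially. P (- A) - e < f (- A) n \<and> f UNIV n < 1 + e"
      by (simp only: eventually_conj)
    then show "\<forall>\<^sub>F n in sequentially. f A n < c"
    proof eventually_elim
      case (elim n)
      have "f A n + f (- A) n = f UNIV n" using f_disj[of A "- A" n] by simp
      then show ?case using elim PU unfolding e_def by argo
    qed
  qed
  then show ?thesis unfolding f_def P_def .
qed

section \<open>The Gauss measure is an invariant probability measure\<close>

lemma measurable_gauss_map [measurable]: "gauss_map \<in> borel_measurable borel"
  unfolding gauss_map_def by measurable

lemma sets_gauss_measure [simp, measurable_cong]: "sets gauss_measure = sets borel"
  by (simp add: gauss_measure_def)

lemma space_gauss_measure [simp]: "space gauss_measure = UNIV"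
  by (simp add: gauss_measure_def)

text \<open>A set of full Gauss measure that \<open>gauss_map\<close> maps into itself. On it,
  expansions are infinite and no floor is ambiguous, so pointwise arguments take place here.\<close>

definition unit_irrationals :: "real set" where
  "unit_irrationals = {0<..<1} - \<rat>"

lemma AE_gauss_measure: "AE y in gauss_measure. y \<in> unit_irrationals"
proof -
  have "AE y in lborel. y \<notin> (\<rat> :: real set)"
    by (rule AE_not_in) (intro countable_imp_null_set_lborel countable_rat)
  then show ?thesis
    unfolding gauss_measure_def
    by (subst AE_density) (auto simp: unit_irrationals_def indicator_def elim!: eventually_mono)
qed

lemma emeasure_gauss_measure_Icc:
  assumes "0 \<le> a" "a \<le> b" "b \<le> 1"
  shows "emeasure gauss_measure {a..b} = ennreal ((ln (1 + b) - ln (1 + a)) / ln 2)"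
proof -
  have "emeasure gauss_measure {a..b} =
      (\<integral>\<^sup>+ y. ennreal (indicator {0<..<1} y * (1 / ln 2) * (1 / (1 + y))) * indicator {a..b} y \<partial>lborel)"
    unfolding gauss_measure_def by (subst emeasure_density) auto
  also have "\<dots> = (\<integral>\<^sup>+ y. ennreal (1 / (1 + y) / ln 2) * indicator {a..b} y \<partial>lborel)"
  proof (rule nn_integral_cong_AE)
    \<comment> \<open>The density vanishes at 0 and 1, while the fundamental theorem of calculus is
      applied to the plain formula on the closed interval; the two differ only at these
      points.\<close>
    have "AE y in lborel. y \<noteq> (0::real)" "AE y in lborel. y \<noteq> (1::real)"
      by (rule AE_lborel_singleton)+
    then show "AE y in lborel. ennreal (indicator {0<..<1} y * (1 / ln 2) * (1 / (1 + y))) * indicator {a..b} y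
        = ennreal (1 / (1 + y) / ln 2) * indicator {a..b} y"
      by eventually_elim (use assms in \<open>auto simp: indicator_def mult.commute\<close>)
  qed
  also have "\<dots> = ennreal (ln (1 + b) / ln 2 - ln (1 + a) / ln 2)"
    using assms
    by (intro nn_integral_FTC_Icc) (auto intro!: derivative_eq_intros)
  finally show ?thesis by (simp add: diff_divide_distrib)
qed

lemma prob_space_gauss_measure: "prob_space gauss_measure"
proof
  have "emeasure gauss_measure (space gauss_measure) = emeasure gauss_measure {0..1}"
    using AE_gauss_measure by (intro emeasure_eq_AE) (auto simp: unit_irrationals_def)
  then show "emeasure gauss_measure (space gauss_measure) = 1"
    by (simp add: emeasure_gauss_measure_Icc)
qed

interpretation gauss: prob_space gauss_measure by (rule prob_space_gauss_measure)

lemma measure_gauss_measure_Icc: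
  assumes "0 \<le> a" "a \<le> b" "b \<le> 1"
  shows "measure gauss_measure {a..b} = (ln (1 + b) - ln (1 + a)) / ln 2"
  using assms by (simp add: measure_def emeasure_gauss_measure_Icc)

section \<open>Invariance of the Gauss measure under the Gauss map\<close>

lemma gauss_map_eq_frac: "gauss_map y = frac (1 / y)"
  by (simp add: gauss_map_def frac_def)

lemma gauss_map_in_unit_irrationals:
  assumes "y \<in> unit_irrationals" shows "gauss_map y \<in> unit_irrationals"
proof -
  have "1 / y \<notin> \<rat>"
  proof
    assume "1 / y \<in> \<rat>"
    then have "inverse (1 / y) \<in> \<rat>" by (rule Rats_inverse)
    then show False using assms by (simp add: unit_irrationals_def)
  qed
  then have irr: "gauss_map y \<notin> \<rat>"
    unfolding gauss_map_def by (metis Rats_add Rats_of_int diff_add_cancel)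
  then have "gauss_map y \<noteq> 0" by (metis Rats_0)
  then show ?thesis
    using irr frac_ge_0[of "1 / y"] frac_lt_1[of "1 / y"]
    by (auto simp: unit_irrationals_def gauss_map_eq_frac)
qed

lemma gauss_map_funpow_in_unit_irrationals:
  "y \<in> unit_irrationals \<Longrightarrow> (gauss_map ^^ i) y \<in> unit_irrationals"
  by (induction i) (auto intro: gauss_map_in_unit_irrationals)

text \<open>The inverse branches of the Gauss map: the index \<open>n\<close> corresponds to the
  floor \<open>n + 1\<close> of \<open>1 / y\<close>. The bound \<open>t < 1\<close> keeps the
  branches apart.\<close>

lemma gauss_map_le_iff:
  assumes "y \<in> unit_irrationals" "0 \<le> t" "t < 1"
  shows "gauss_map y \<le> t \<longleftrightarrow> (\<exists>n::nat. y \<in> {1 / (real n + 1 + t)..1 / (real n + 1)})"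
proof
  have y: "0 < y" "y < 1" using assms by (auto simp: unit_irrationals_def)
  {
    assume le: "gauss_map y \<le> t"
    have "1 \<le> \<lfloor>1 / y\<rfloor>" using y by (simp add: le_floor_iff)
    then obtain n where n: "\<lfloor>1 / y\<rfloor> = int n + 1"
      by (metis add.commute zle_iff_zadd)
    then have "real n + 1 \<le> 1 / y" "1 / y \<le> real n + 1 + t"
      using le of_int_floor_le[of "1 / y"] by (auto simp: gauss_map_def)
    then show "\<exists>n::nat. y \<in> {1 / (real n + 1 + t)..1 / (real n + 1)}"
      using y assms by (intro exI[of _ n]) (auto simp: field_simps)
  next
    assume "\<exists>n::nat. y \<in> {1 / (real n + 1 + t)..1 / (real n + 1)}"
    then obtain n :: nat where "y \<in> {1 / (real n + 1 + t)..1 / (real n + 1)}" ..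
    then have n: "real n + 1 \<le> 1 / y" "1 / y \<le> real n + 1 + t"
      using y assms by (auto simp: field_simps)
    then have "\<lfloor>1 / y\<rfloor> = int n + 1" using assms by (intro floor_unique) auto
    then show "gauss_map y \<le> t" using n by (simp add: gauss_map_def)
  }
qed

lemma gauss_branches_sums:
  fixes t :: real
  assumes "0 \<le> t"
  shows "(\<lambda>n. (ln (1 + 1 / (real n + 1)) - ln (1 + 1 / (real n + 1 + t))) / ln 2) sums (ln (1 + t) / ln 2)"
proof -
  \<comment> \<open>Each branch contributes a difference of consecutive values of \<open>F\<close>,
    so the series telescopes to \<open>- F 0 = ln (1 + t)\<close>, up to the factor
    \<open>1 / ln 2\<close>.\<close>
  define F where "F n = ln (real n + 1) - ln (real n + 1 + t)" for n :: nat
  have "F \<longlonglongrightarrow> 0"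
    unfolding F_def using assms by real_asymp
  then have "(\<lambda>n. F (Suc n) - F n) sums (0 - F 0)" by (rule telescope_sums)
  moreover have "F (Suc n) - F n = ln (1 + 1 / (real n + 1)) - ln (1 + 1 / (real n + 1 + t))" for n
  proof -
    have "1 + 1 / (real n + 1) = (real n + 2) / (real n + 1)"
      "1 + 1 / (real n + 1 + t) = (real n + 2 + t) / (real n + 1 + t)"
      using assms by (auto simp: field_simps)
    then show ?thesis using assms by (simp add: F_def ln_div algebra_simps)
  qed
  ultimately show ?thesis using assms by (intro sums_divide) (simp add: F_def)
qed

lemma measure_gauss_map_le:
  assumes t: "0 \<le> t" "t < 1"
  shows "measure gauss_measure {y. gauss_map y \<le> t} = ln (1 + t) / ln 2"
proof -
  define I where "I n = {1 / (real n + 1 + t)..1 / (real n + 1)}" for n :: nat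
  have I_meas: "I n \<in> sets borel" for n by (simp add: I_def)
  have "disjoint_family I"
    unfolding disjoint_family_on_def
  proof (intro ballI impI)
    have "I m \<inter> I n = {}" if "m < n" for m n :: nat
    proof -
      have "1 / (real n + 1) < 1 / (real m + 1 + t)"
        using that t by (intro divide_strict_left_mono mult_pos_pos) linarith+
      then show ?thesis by (auto simp: I_def)
    qed
    then show "I m \<inter> I n = {}" if "m \<noteq> n" for m n
      using that by (metis inf_commute linorder_neqE_nat)
  qed
  then have "(\<lambda>n. measure gauss_measure (I n)) sums measure gauss_measure (\<Union>n. I n)"
    by (intro gauss.finite_measure_UNION) (auto simp: I_meas)
  moreover have "measure gauss_measure (I n) = (ln (1 + 1 / (real n + 1)) - ln (1 + 1 / (real n + 1 + t))) / ln 2" for n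
    unfolding I_def using t by (intro measure_gauss_measure_Icc) (auto simp: field_simps)
  ultimately have "measure gauss_measure (\<Union>n. I n) = ln (1 + t) / ln 2"
    using gauss_branches_sums[OF t(1)] by (simp add: sums_unique2)
  moreover have "measure gauss_measure {y. gauss_map y \<le> t} = measure gauss_measure (\<Union>n. I n)"
    using AE_gauss_measure
  proof (intro gauss.finite_measure_eq_AE)
    show "{y. gauss_map y \<le> t} \<in> sets gauss_measure" by simp
    show "AE y in gauss_measure. (y \<in> {y. gauss_map y \<le> t}) = (y \<in> (\<Union>n. I n))"
      using AE_gauss_measure by eventually_elim (use gauss_map_le_iff t in \<open>auto simp: I_def\<close>)
  qed (auto simp: I_def)
  ultimately show ?thesis by simp
qed

text \<open>Equality of the distribution functions suffices. The sum over the branches gives it for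
  \<open>t\<close> in [0,1); elsewhere both functions are 0 or 1, as both measures are concentrated
  on (0,1).\<close>

lemma distr_gauss_map: "distr gauss_measure borel gauss_map = gauss_measure"
proof (rule cdf_unique)
  show "real_distribution (distr gauss_measure borel gauss_map)"
    by (rule gauss.real_distribution_distr) simp
  show "real_distribution gauss_measure"
    by unfold_locales auto
  have "cdf (distr gauss_measure borel gauss_map) t = cdf gauss_measure t" for t
  proof -
    have "cdf (distr gauss_measure borel gauss_map) t = measure gauss_measure {y. gauss_map y \<le> t}"
      by (simp add: cdf_def measure_distr vimage_def)
    also have "\<dots> = measure gauss_measure {..t}"
    proof (cases "0 \<le> t \<and> t < 1")
      case True
      have "measure gauss_measure {..t} = measure gauss_measure {0..t}"
        using AE_gauss_measure
        by (intro gauss.finite_measure_eq_AE) (auto simp: unit_irrationals_def elim!: eventually_mono)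
      then show ?thesis using True by (simp add: measure_gauss_map_le measure_gauss_measure_Icc)
    next
      case False
      show ?thesis
      proof (rule gauss.finite_measure_eq_AE)
        show "AE y in gauss_measure. (y \<in> {y. gauss_map y \<le> t}) = (y \<in> {..t})"
          using AE_gauss_measure
        proof eventually_elim
          case (elim y)
          then have "y \<in> {0<..<1}" "gauss_map y \<in> {0<..<1}"
            using gauss_map_in_unit_irrationals[of y] by (auto simp: unit_irrationals_def)
          then show ?case using False by auto
        qed
      qed auto
    qed
    finally show ?thesis by (simp add: cdf_def)
  qed
  then show "cdf (distr gauss_measure borel gauss_map) = cdf gauss_measure" by auto
qed

lemma measurable_gauss_map_funpow [measurable]: "gauss_map ^^ i \<in> borel_measurable borel"
  by (induction i) (auto simp: comp_def)

text \<open>Makes the measure of an occurrence of a string independent of its offset inside a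
  block.\<close>

lemma measure_gauss_map_funpow:
  assumes [measurable]: "Measurable.pred borel Q"
  shows "measure gauss_measure {y. Q ((gauss_map ^^ i) y)} = measure gauss_measure {y. Q y}"
proof (induction i)
  case (Suc i)
  have "measure gauss_measure {y. Q ((gauss_map ^^ Suc i) y)} =
      measure (distr gauss_measure borel gauss_map) {y. Q ((gauss_map ^^ i) y)}"
    by (subst measure_distr) (auto simp: funpow_Suc_right vimage_def simp del: funpow.simps)
  then show ?case by (simp only: distr_gauss_map Suc)
qed simp

section \<open>Cylinders and partial quotients\<close>

text \<open>The first \<open>k\<close> partial quotients, read off the Gauss orbit instead of a
  limit. This is total and visibly measurable; outside the irrationals of (0,1) the values carry no
  meaning.\<close>

definition cf_block :: "nat \<Rightarrow> real \<Rightarrow> nat list" where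
  "cf_block k y = map (\<lambda>i. nat \<lfloor>1 / (gauss_map ^^ i) y\<rfloor>) [0..<k]"

lemma cf_value_bounds:
  assumes "\<forall>a\<in>set w. a \<ge> 1"
  shows "0 \<le> cf_value w \<and> cf_value w \<le> 1"
  using assms by (induction w) (auto simp: field_simps add_increasing2)

text \<open>Inverting the convergents shows that those of the shifted sequence tend to
  \<open>1 / y - a 0\<close>. This limit lies in [0,1], so it is the fractional part of
  \<open>1 / y\<close> unless it equals 1.\<close>

lemma is_cf_expansion_shift:
  assumes "is_cf_expansion a y" "y \<in> unit_irrationals"
  shows "a 0 = nat \<lfloor>1 / y\<rfloor>" "is_cf_expansion (\<lambda>i. a (Suc i)) (gauss_map y)"
proof -
  have a: "a i \<ge> 1" for i
    using assms(1) by (auto simp: is_cf_expansion_def)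
  have lim: "(\<lambda>m. cf_value (map a [0..<m])) \<longlonglongrightarrow> y"
    using assms(1) by (auto simp: is_cf_expansion_def)
  have y: "0 < y" "y < 1" using assms(2) by (auto simp: unit_irrationals_def)
  define c where "c m = cf_value (map (\<lambda>i. a (Suc i)) [0..<m])" for m
  have c: "0 \<le> c m" "c m \<le> 1" for m
    using cf_value_bounds[of "map (\<lambda>i. a (Suc i)) [0..<m]"] a by (auto simp: c_def)
  have Suc: "cf_value (map a [0..<Suc m]) = 1 / (real (a 0) + c m)" for m
    by (simp add: c_def upt_conv_Cons map_Suc_upt[symmetric] comp_def del: upt_Suc)
  have "(\<lambda>m. 1 / cf_value (map a [0..<Suc m]) - real (a 0)) \<longlonglongrightarrow> 1 / y - real (a 0)"
    using y by (intro tendsto_intros LIMSEQ_Suc lim) auto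
  then have lim_c: "c \<longlonglongrightarrow> 1 / y - real (a 0)" by (simp add: Suc del: upt_Suc)
  have ge: "0 \<le> 1 / y - real (a 0)" and le: "1 / y - real (a 0) \<le> 1"
    using LIMSEQ_le_const[OF lim_c] LIMSEQ_le_const2[OF lim_c] c by blast+
  \<comment> \<open>At the endpoint 1 the floor would be \<open>a 0 + 1\<close>; irrationality of
    \<open>y\<close> excludes this.\<close>
  have "1 / y - real (a 0) \<noteq> 1"
  proof
    assume "1 / y - real (a 0) = 1"
    then have "y = 1 / (1 + real (a 0))" using y by (simp add: field_simps)
    then show False using assms(2) by (simp add: unit_irrationals_def)
  qed
  then have fl: "\<lfloor>1 / y\<rfloor> = int (a 0)" using ge le by (intro floor_unique) auto
  then show "a 0 = nat \<lfloor>1 / y\<rfloor>" by simp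
  show "is_cf_expansion (\<lambda>i. a (Suc i)) (gauss_map y)"
    using a lim_c by (simp add: is_cf_expansion_def gauss_map_def fl c_def[abs_def])
qed

lemma is_cf_expansion_unique:
  assumes "is_cf_expansion a y" "y \<in> unit_irrationals"
  shows "a i = nat \<lfloor>1 / (gauss_map ^^ i) y\<rfloor>"
  using assms
proof (induction i arbitrary: a y)
  case 0
  then show ?case using is_cf_expansion_shift(1) by simp
next
  case (Suc i)
  then show ?case
    using is_cf_expansion_shift(2)[OF Suc.prems] gauss_map_in_unit_irrationals
    by (simp add: funpow_swap1)
qed

lemma unit_irrationals_eq:
  assumes "y \<in> unit_irrationals"
  shows "nat \<lfloor>1 / y\<rfloor> \<ge> 1" "y = 1 / (real (nat \<lfloor>1 / y\<rfloor>) + gauss_map y)"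
proof -
  have y: "0 < y" "y < 1" using assms by (auto simp: unit_irrationals_def)
  then have *: "\<lfloor>1 / y\<rfloor> \<ge> 1" by (simp add: le_floor_iff)
  then show "nat \<lfloor>1 / y\<rfloor> \<ge> 1" by linarith
  have "real (nat \<lfloor>1 / y\<rfloor>) = of_int \<lfloor>1 / y\<rfloor>" by (rule of_nat_nat) (use * in linarith)
  then show "y = 1 / (real (nat \<lfloor>1 / y\<rfloor>) + gauss_map y)" by (simp add: gauss_map_def)
qed

section \<open>Blocks of partial quotients and convergence of the expansion\<close>

lemma cf_block_0 [simp]: "cf_block 0 y = []"
  by (simp add: cf_block_def)

lemma cf_block_Suc: "cf_block (Suc k) y = nat \<lfloor>1 / y\<rfloor> # cf_block k (gauss_map y)"
  unfolding cf_block_def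
  by (simp add: upt_conv_Cons map_Suc_upt[symmetric] comp_def funpow_swap1 del: upt_Suc)

lemma length_cf_block [simp]: "length (cf_block k y) = k"
  by (simp add: cf_block_def)

lemma cf_block_ge_1: "y \<in> unit_irrationals \<Longrightarrow> \<forall>a\<in>set (cf_block k y). a \<ge> 1"
  using unit_irrationals_eq(1) gauss_map_funpow_in_unit_irrationals by (auto simp: cf_block_def)

text \<open>Occurrence of a string at offset \<open>j\<close> is thus a property of the whole block,
  to which frequencies of blocks apply.\<close>

lemma take_drop_cf_block:
  assumes "j + m \<le> k"
  shows "take m (drop j (cf_block k y)) = cf_block m ((gauss_map ^^ j) y)"
  using assms
  by (intro nth_equalityI) (simp_all add: cf_block_def add.commute[of j] funpow_add)

text \<open>One step of the expansion contracts the error by at most \<open>y\<close>, and two steps by at most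
  \<open>y * gauss_map y \<le> 1 / 2\<close>.\<close>

lemma cf_value_cf_block_error:
  assumes "y \<in> unit_irrationals"
  shows "\<bar>cf_value (cf_block m y) - y\<bar> \<le> (1 / 2) ^ (m div 2)"
  using assms
proof (induction m arbitrary: y rule: nat_induct2)
  case 0
  then show ?case by (auto simp: unit_irrationals_def)
next
  case 1
  then show ?case
    using cf_value_bounds[of "cf_block 1 y"] cf_block_ge_1[of y 1] by (auto simp: unit_irrationals_def)
next
  case (step m)
  have one: "\<bar>cf_value (cf_block (Suc k) z) - z\<bar> \<le> \<bar>cf_value (cf_block k (gauss_map z)) - gauss_map z\<bar> * z"
    if z: "z \<in> unit_irrationals" for k z
  proof -
    define a where "a = real (nat \<lfloor>1 / z\<rfloor>)"
    define g where "g = gauss_map z"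
    define c where "c = cf_value (cf_block k g)"
    have g: "g \<in> unit_irrationals" using z by (simp add: g_def gauss_map_in_unit_irrationals)
    have a: "a \<ge> 1" using unit_irrationals_eq(1)[OF z] by (simp add: a_def)
    have c: "c \<ge> 0" using cf_value_bounds cf_block_ge_1[OF g] by (simp add: c_def)
    have g0: "g > 0" using g by (simp add: unit_irrationals_def)
    have zeq: "z = 1 / (a + g)" using unit_irrationals_eq(2)[OF z] by (simp add: a_def g_def)
    have "cf_value (cf_block (Suc k) z) - z = 1 / (a + c) - 1 / (a + g)"
      by (subst (2) zeq) (simp add: cf_block_Suc a_def c_def g_def)
    also have "\<dots> = (g - c) * z * (1 / (a + c))"
      unfolding zeq using a c g0 by (simp add: divide_simps)
    finally have "\<bar>cf_value (cf_block (Suc k) z) - z\<bar> = \<bar>c - g\<bar> * z * (1 / (a + c))"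
      using a c g0 zeq by (simp add: abs_mult abs_minus_commute)
    also have "\<dots> \<le> \<bar>c - g\<bar> * z * 1"
      using a c g0 by (intro mult_left_mono) (auto simp: zeq)
    finally show ?thesis by (simp add: c_def g_def)
  qed
  define g where "g = gauss_map y"
  have g: "g \<in> unit_irrationals" using step.prems by (simp add: g_def gauss_map_in_unit_irrationals)
  have g01: "0 < g" "g < 1" "0 < y" using g step.prems by (auto simp: unit_irrationals_def)
  have "g * y \<le> 1 / 2"
  \<comment> \<open>With \<open>y = 1 / (b + g)\<close> and \<open>g < 1 \<le> b\<close>, the
    product is \<open>g / (b + g)\<close>, at most one half.\<close>
  proof -
    have a: "real (nat \<lfloor>1 / y\<rfloor>) \<ge> 1" using unit_irrationals_eq(1)[OF step.prems] by simp
    define b where "b = real (nat \<lfloor>1 / y\<rfloor>)"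
    have b: "b \<ge> 1" using a by (simp add: b_def)
    have "y = 1 / (b + g)" using unit_irrationals_eq(2)[OF step.prems] by (simp add: b_def g_def)
    then have "g * y = g / (b + g)" by simp
    also have "\<dots> \<le> 1 / 2" using b g01(1,2) by (simp add: divide_simps)
    finally show ?thesis .
  qed
  have "\<bar>cf_value (cf_block (m + 2) y) - y\<bar> \<le> \<bar>cf_value (cf_block (Suc m) g) - g\<bar> * y"
    using one[OF step.prems, of "Suc m"] by (simp add: g_def)
  also have "\<dots> \<le> (\<bar>cf_value (cf_block m (gauss_map g)) - gauss_map g\<bar> * g) * y"
    using one[OF g, of m] g01 by (intro mult_right_mono) auto
  also have "\<dots> = \<bar>cf_value (cf_block m (gauss_map g)) - gauss_map g\<bar> * (g * y)" by simp
  also have "\<dots> \<le> (1 / 2) ^ (m div 2) * (1 / 2)"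
    using step.IH[OF gauss_map_in_unit_irrationals[OF g]] \<open>g * y \<le> 1 / 2\<close> g01
    by (intro mult_mono) auto
  finally show ?case by simp
qed

lemma is_cf_expansion_exists:
  assumes "y \<in> unit_irrationals"
  shows "is_cf_expansion (\<lambda>i. nat \<lfloor>1 / (gauss_map ^^ i) y\<rfloor>) y"
proof -
  have "(\<lambda>m. (1 / 2 :: real) ^ (m div 2)) \<longlonglongrightarrow> 0"
    by (rule filterlim_compose[OF LIMSEQ_power_zero filterlim_at_top_div_const_nat]) auto
  then have "(\<lambda>m. cf_value (cf_block m y) - y) \<longlonglongrightarrow> 0"
    by (rule Lim_null_comparison[rotated]) (use cf_value_cf_block_error assms in auto)
  then have "(\<lambda>m. cf_value (cf_block m y)) \<longlonglongrightarrow> y" by (simp add: LIM_zero_iff)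
  then show ?thesis
    using unit_irrationals_eq(1) gauss_map_funpow_in_unit_irrationals[OF assms]
    by (simp add: is_cf_expansion_def cf_block_def)
qed

text \<open>Existence and uniqueness of the expansion replace the existential quantifier in
  \<open>cylinder\<close> by the digits of the Gauss orbit.\<close>

lemma mem_cylinder_iff:
  assumes "y \<in> unit_irrationals"
  shows "y \<in> cylinder w \<longleftrightarrow> cf_block (length w) y = w"
proof -
  define d where "d = (\<lambda>i. nat \<lfloor>1 / (gauss_map ^^ i) y\<rfloor>)"
  have "is_cf_expansion a y \<longleftrightarrow> a = d" for a
    using is_cf_expansion_exists[OF assms] is_cf_expansion_unique[OF _ assms, of a] by (auto simp: d_def)
  then have "y \<in> cylinder w \<longleftrightarrow> (\<forall>i<length w. d i = w ! i)"
    using assms by (simp add: cylinder_def unit_irrationals_def)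
  also have "\<dots> \<longleftrightarrow> (\<forall>i<length w. cf_block (length w) y ! i = w ! i)"
    by (simp add: cf_block_def d_def)
  also have "\<dots> \<longleftrightarrow> cf_block (length w) y = w"
    by (subst list_eq_iff_nth_eq) (simp only: length_cf_block simp_thms)
  finally show ?thesis .
qed

lemma measurable_cf_block [measurable]: "cf_block k \<in> measurable borel (count_space UNIV)"
proof (induction k)
  case 0
  then show ?case by (simp add: cf_block_def[abs_def])
next
  case (Suc k)
  note [measurable] = Suc
  have "(\<lambda>y. nat \<lfloor>1 / y\<rfloor> # cf_block k (gauss_map y)) \<in> measurable borel (count_space UNIV)"
    by measurable
  then show ?case by (simp add: cf_block_Suc[abs_def])
qed

text \<open>The two sets agree almost everywhere. What needs care is that the cylinder is Borel, as
  its definition quantifies over sequences: outside the rationals it coincides with a Borel set, and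
  the rest is countable.\<close>

lemma measure_cylinder:
  "measure gauss_measure (cylinder w) = measure gauss_measure {y. cf_block (length w) y = w}"
proof (rule gauss.finite_measure_eq_AE)
  show "AE y in gauss_measure. (y \<in> cylinder w) = (y \<in> {y. cf_block (length w) y = w})"
    using AE_gauss_measure by eventually_elim (simp add: mem_cylinder_iff)
  show m: "{y. cf_block (length w) y = w} \<in> sets gauss_measure" by simp
  have R: "B \<in> sets borel" if "B \<subseteq> \<rat>" for B :: "real set"
  proof (rule sets.countable)
    show "countable B" using that countable_rat by (rule countable_subset)
  qed simp
  have "y \<in> unit_irrationals" if "y \<in> cylinder w" "y \<notin> \<rat>" for y
  proof -
    have "0 \<le> y" "y \<le> 1" "y \<noteq> 0" "y \<noteq> 1" using that by (auto simp: cylinder_def)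
    then show ?thesis using that by (simp add: unit_irrationals_def)
  qed
  moreover have "y \<in> cylinder w \<longleftrightarrow> y \<in> {y. cf_block (length w) y = w}" if "y \<in> unit_irrationals" for y
    using mem_cylinder_iff[OF that, of w] by blast
  ultimately have "cylinder w = ({y. cf_block (length w) y = w} \<inter> unit_irrationals) \<union> (cylinder w \<inter> \<rat>)"
    by blast
  also have "\<dots> \<in> sets borel"
    using m R[of "\<rat>"] R[of "cylinder w \<inter> \<rat>"] by (simp add: unit_irrationals_def sets.Int sets.Un sets.Diff)
  finally show "cylinder w \<in> sets gauss_measure" by simp
qed

section \<open>From aligned blocks to all positions\<close>

text \<open>Provides the normalisation of the total frequency. The indices from 0 to
  \<open>n div k\<close> number \<open>n div k + 1\<close>, which lies between \<open>n / k\<close>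
  and \<open>n / k + 1\<close>.\<close>

lemma card_atMost_div_tendsto:
  fixes k :: nat
  assumes "k \<ge> 1"
  shows "(\<lambda>n. real (card {..n div k}) / (real n / real k)) \<longlonglongrightarrow> 1"
proof (rule tendsto_sandwich)
  have "1 \<le> real (card {..n div k}) / (real n / real k) \<and>
      real (card {..n div k}) / (real n / real k) \<le> 1 + real k / real n" if "n \<ge> 1" for n
  proof -
    have "n div k * k \<le> n" "n \<le> (n div k + 1) * k"
      using assms dividend_less_div_times[of k n] by (auto simp: less_imp_le)
    then have "real (n div k) * real k \<le> real n" "real n \<le> (real (n div k) + 1) * real k"
      by (metis of_nat_le_iff of_nat_mult of_nat_add of_nat_1)+
    then have "real n \<le> (real (n div k) + 1) * real k" "(real (n div k) + 1) * real k \<le> real n + real k"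
      by (simp_all add: algebra_simps)
    then have "1 \<le> (real (n div k) + 1) * real k / real n"
      "(real (n div k) + 1) * real k / real n \<le> 1 + real k / real n"
      using that by (simp_all add: divide_simps)
    moreover have "real (card {..n div k}) / (real n / real k) = (real (n div k) + 1) * real k / real n"
      by simp
    ultimately show ?thesis by (simp only: simp_thms)
  qed
  then show "\<forall>\<^sub>F n in sequentially. 1 \<le> real (card {..n div k}) / (real n / real k)"
    "\<forall>\<^sub>F n in sequentially. real (card {..n div k}) / (real n / real k) \<le> 1 + real k / real n"
    by (auto intro: eventually_sequentiallyI[of 1])
  show "(\<lambda>n. 1 + real k / real n) \<longlonglongrightarrow> 1" by real_asymp
qed simp

text \<open>Only the last block can reach beyond \<open>n\<close>, which costs at most one hit per offset.\<close>

lemma card_offsets_le: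
  fixes k l n :: nat
  assumes "l < k"
  shows "(\<Sum>j\<le>l. card {i. i \<le> n div k \<and> Q (k * i + j)}) \<le> card {t. t \<le> n \<and> Q t} + (l + 1)"
proof -
  \<comment> \<open>The strict inequality discards the block with index \<open>n div k\<close>, the
    only one that may pass \<open>n\<close>.\<close>
  define D where "D j = {i. i < n div k \<and> Q (k * i + j)}" for j
  have fD: "finite (D j)" for j by (simp add: D_def)
  have "card {i. i \<le> n div k \<and> Q (k * i + j)} \<le> card (D j) + 1" for j
  proof -
    have "card {i. i \<le> n div k \<and> Q (k * i + j)} \<le> card (insert (n div k) (D j))"
      by (intro card_mono) (auto simp: fD, auto simp: D_def)
    also have "\<dots> \<le> card (D j) + 1" by (simp add: fD card_insert_if)
    finally show ?thesis .
  qed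
  then have "(\<Sum>j\<le>l. card {i. i \<le> n div k \<and> Q (k * i + j)}) \<le> (\<Sum>j\<le>l. card (D j) + 1)"
    by (intro sum_mono)
  also have "\<dots> = card (Sigma {..l} D) + (l + 1)"
    by (simp add: sum_Suc card_SigmaI fD del: sum.atMost_Suc)
  also have "card (Sigma {..l} D) \<le> card {t. t \<le> n \<and> Q t}"
  proof (rule card_inj_on_le)
    \<comment> \<open>Offsets are below \<open>k\<close>, so \<open>j\<close> and \<open>i\<close>
      are remainder and quotient of the position modulo \<open>k\<close>.\<close>
    show "inj_on (\<lambda>(j, i). k * i + j) (Sigma {..l} D)"
    proof (rule inj_onI, clarsimp)
      fix j i j' i' assume *: "j \<le> l" "j' \<le> l" "k * i + j = k * i' + j'"
      then have "j < k" "j' < k" using assms by auto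
      then have "(k * i + j) mod k = j" "(k * i' + j') mod k = j'"
        "(k * i + j) div k = i" "(k * i' + j') div k = i'" by auto
      then show "j = j' \<and> i = i'" using *(3) by metis
    qed
    have "k * i + j \<le> n" if "j \<le> l" "i < n div k" for i j
    proof -
      have "k * i + j \<le> k * Suc i" using that assms by simp
      also have "\<dots> \<le> k * (n div k)" using that by (intro mult_le_mono2) simp
      also have "\<dots> \<le> n" by simp
      finally show ?thesis .
    qed
    then show "(\<lambda>(j, i). k * i + j) ` Sigma {..l} D \<subseteq> {t. t \<le> n \<and> Q t}"
      by (auto simp: D_def)
  qed simp
  finally show ?thesis by simp
qed

theorem theorem3p1:
  fixes x :: real
  assumes "x \<in> {0<..<1}" and "x \<notin> \<rat>"
    and "\<And>(k::nat) (s::nat list). k \<ge> 1 \<Longrightarrow> length s = k \<Longrightarrow> (\<forall>a\<in>set s. a \<ge> 1) \<Longrightarrow>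
      (\<lambda>n::nat. real (card {i::nat. real i \<le> real n / real k \<and>
                              (gauss_map ^^ (k * i)) x \<in> cylinder s}) / (real n / real k))
        \<longlonglongrightarrow> measure gauss_measure (cylinder s)"
  shows "\<forall>s::nat list. (\<forall>a\<in>set s. a \<ge> 1) \<longrightarrow>
      (\<lambda>n::nat. real (card {i::nat. i \<le> n \<and> (gauss_map ^^ i) x \<in> cylinder s}) / real n)
        \<longlonglongrightarrow> measure gauss_measure (cylinder s)"
proof (intro allI impI)
  fix s :: "nat list" assume s: "\<forall>a\<in>set s. a \<ge> 1"
  have x: "x \<in> unit_irrationals" using assms(1,2) by (simp add: unit_irrationals_def)
  have in_cylinder: "(gauss_map ^^ i) x \<in> cylinder w \<longleftrightarrow> cf_block (length w) ((gauss_map ^^ i) x) = w" for i w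
    by (intro mem_cylinder_iff gauss_map_funpow_in_unit_irrationals x)
  \<comment> \<open>The hypothesis concerns single strings; here it extends to arbitrary sets
    \<open>A\<close> of blocks.\<close>
  have aligned: "(\<lambda>n. real (card {i. i \<le> n div k \<and> cf_block k ((gauss_map ^^ (k * i)) x) \<in> A}) / (real n / real k))
      \<longlonglongrightarrow> measure gauss_measure {y. cf_block k y \<in> A}" if k: "k \<ge> 1" for k A
  proof -
    have "\<forall>\<^sub>F n in sequentially.
        c < real (card {i. i \<le> n div k \<and> cf_block k ((gauss_map ^^ (k * i)) x) = w}) / (real n / real k)"
      if c: "c < measure gauss_measure {y. cf_block k y = w}" for w c
    proof (cases "length w = k \<and> (\<forall>a\<in>set w. a \<ge> 1)")
      case True
      have "real i \<le> real n / real k \<longleftrightarrow> i \<le> n div k" for i n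
      proof -
        have "real i \<le> real n / real k \<longleftrightarrow> real (i * k) \<le> real n" using k by (simp add: field_simps)
        also have "\<dots> \<longleftrightarrow> i \<le> n div k"
          using k by (simp only: of_nat_le_iff) (simp add: less_eq_div_iff_mult_less_eq)
        finally show ?thesis .
      qed
      then show ?thesis
        using order_tendstoD(1)[OF assms(3)[of k w]] k c True by (simp add: in_cylinder measure_cylinder)
    next
      case False
      have "measure gauss_measure {y. cf_block k y = w} = measure gauss_measure {}"
      proof (rule gauss.finite_measure_eq_AE)
        show "AE y in gauss_measure. (y \<in> {y. cf_block k y = w}) = (y \<in> {})"
          using AE_gauss_measure by eventually_elim (use False cf_block_ge_1 in auto)
      qed auto
      \<comment> \<open>A list of the wrong length or with a zero entry is almost surely not a
        block, so \<open>c\<close> is negative and the bound is trivial.\<close>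
      then show ?thesis using c by (auto intro!: always_eventually less_le_trans[of c 0])
    qed
    then have "(\<lambda>n. real (card {i. i \<le> n div k \<and> cf_block k ((gauss_map ^^ (k * i)) x) \<in> A}) / (real n / real k))
        \<longlonglongrightarrow> measure gauss_measure {y \<in> space gauss_measure. cf_block k y \<in> A}"
      by (intro frequency_tendsto_prob prob_space_gauss_measure card_atMost_div_tendsto k) auto
    then show ?thesis by simp
  qed
  define m where "m = length s"
  define v where "v t = cf_block m ((gauss_map ^^ t) x)" for t
  have "\<forall>\<^sub>F n in sequentially. c < real (card {t. t \<le> n \<and> v t = w}) / real n"
    if c: "c < measure gauss_measure {y. cf_block m y = w}" for w c
  proof -
    define q where "q = measure gauss_measure {y. cf_block m y = w}"
    \<comment> \<open>In blocks of length \<open>m + l + 1\<close> the \<open>l + 1\<close> offsets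
      up to \<open>l\<close> leave room for \<open>w\<close>. The proportion of these offsets tends
      to 1, so a large \<open>l\<close> still beats \<open>c\<close>. The extra 1 in the length
      keeps it positive and above \<open>l\<close> even for the empty string.\<close>
    have "(\<lambda>l. (real l + 1) / (real m + real l + 1) * q) \<longlonglongrightarrow> q" by real_asymp
    then have "\<forall>\<^sub>F l in sequentially. c < (real l + 1) / (real m + real l + 1) * q"
      using c by (intro order_tendstoD) (auto simp: q_def)
    then obtain l where l: "c < (real l + 1) / (real m + real l + 1) * q"
      by (auto simp: eventually_sequentially)
    define k where "k = m + l + 1"
    define C where "C j n = {i. i \<le> n div k \<and> v (k * i + j) = w}" for j n
    have lim: "(\<lambda>n. real (card (C j n)) / (real n / real k)) \<longlonglongrightarrow> q" if j: "j \<le> l" for j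
    proof -
      have td: "take m (drop j (cf_block k y)) = cf_block m ((gauss_map ^^ j) y)" for y
        using j by (intro take_drop_cf_block) (simp add: k_def)
      then have "C j n = {i. i \<le> n div k \<and>
          cf_block k ((gauss_map ^^ (k * i)) x) \<in> {B. take m (drop j B) = w}}" for n
        by (simp add: C_def v_def add.commute[of _ j] funpow_add)
      moreover have "measure gauss_measure {y. cf_block k y \<in> {B. take m (drop j B) = w}} = q"
        unfolding q_def using measure_gauss_map_funpow[of "\<lambda>y. cf_block m y = w" j] by (simp add: td)
      ultimately show ?thesis
        using aligned[of k "{B. take m (drop j B) = w}"] by (simp add: k_def)
    qed
    \<comment> \<open>Division by \<open>k\<close> turns the block normalisation
      \<open>n / k\<close> into \<open>n\<close>; the subtracted term pays for the possible
      overcount in the last block and vanishes in the limit.\<close>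
    have "(\<lambda>n. (\<Sum>j\<le>l. real (card (C j n)) / (real n / real k)) / real k - (real l + 1) / real n)
        \<longlonglongrightarrow> (\<Sum>j\<le>l. q) / real k - 0"
    proof (intro tendsto_diff tendsto_divide tendsto_const)
      show "(\<lambda>n. \<Sum>j\<le>l. real (card (C j n)) / (real n / real k)) \<longlonglongrightarrow> (\<Sum>j\<le>l. q)"
        by (rule tendsto_sum) (simp only: lim atMost_iff)
      show "(\<lambda>n. (real l + 1) / real n) \<longlonglongrightarrow> 0" by real_asymp
    qed (simp add: k_def)
    moreover have "c < (\<Sum>j\<le>l. q) / real k - 0"
      using l by (simp add: k_def algebra_simps)
    ultimately have "\<forall>\<^sub>F n in sequentially.
        c < (\<Sum>j\<le>l. real (card (C j n)) / (real n / real k)) / real k - (real l + 1) / real n"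
      by (rule order_tendstoD)
    then show ?thesis
    proof eventually_elim
      case (elim n)
      have "(\<Sum>j\<le>l. card (C j n)) \<le> card {t. t \<le> n \<and> v t = w} + (l + 1)"
        unfolding C_def by (rule card_offsets_le) (simp add: k_def)
      then have "(\<Sum>j\<le>l. real (card (C j n))) \<le> real (card {t. t \<le> n \<and> v t = w}) + (real l + 1)"
        unfolding of_nat_sum[symmetric] by linarith
      then have "(\<Sum>j\<le>l. real (card (C j n))) / real n \<le>
          (real (card {t. t \<le> n \<and> v t = w}) + (real l + 1)) / real n"
        by (rule divide_right_mono) simp
      moreover have "(\<Sum>j\<le>l. real (card (C j n)) / (real n / real k)) / real k =
          (\<Sum>j\<le>l. real (card (C j n))) / real n"
        by (simp add: sum_divide_distrib k_def)
      ultimately show ?case using elim by (simp add: add_divide_distrib)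
    qed
  qed
  \<comment> \<open>The lower bounds hold for every list \<open>w\<close>, so the frequency lemma
    applies again, now to all positions, and makes the bound for \<open>s\<close> a limit.\<close>
  then have "(\<lambda>n. real (card {t. t \<le> n \<and> v t \<in> {s}}) / real n)
      \<longlonglongrightarrow> measure gauss_measure {y \<in> space gauss_measure. cf_block m y \<in> {s}}"
    using card_atMost_div_tendsto[of 1]
    by (intro frequency_tendsto_prob prob_space_gauss_measure) (simp_all del: card_atMost)
  then show "(\<lambda>n::nat. real (card {i::nat. i \<le> n \<and> (gauss_map ^^ i) x \<in> cylinder s}) / real n)
        \<longlonglongrightarrow> measure gauss_measure (cylinder s)"
    by (simp add: in_cylinder measure_cylinder v_def m_def)
qed

end
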